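(* Let $s\ge 1$ and $n=s-1$. Let $F=(\Sigma^{s},\oplus,\otimes)$, regarded as an $n$i-signed-field, and let $V=(\Sigma^{s},\oplus,\otimes)$ be the $n$i-signed-vector space over $F$ whose addition is $\oplus$ and whose scalar multiplication $F\times V\to V$ is $\otimes$. Then $V$, equipped with the multiplication $\otimes:V\times V\to V$, forms an $n$i-signed-algebra $A=(\Sigma^{s},\oplus,\otimes)$ over $F$.
   Context: **Magnitudes.** $P$ is a non-empty set with two binary operations $+$ and $\cdot$ such that: $(P,+)$ is a commutative monoid with identity $0$; $(P\setminus\{0\},\cdot)$ is an abelian group (its identity is written $1$); and $\cdot$ distributes over $+$ on both sides. Moreover $(P,+,\le)$ is a totally ordered (with translation-invariant order) cancellative commutative monoid, such that whenever $a\ge b$ there is a unique $c\in P$ with $b+c=a$, denoted $a-b$. Finally, $P$ has no nonzero additive inverses: if $a,b\in P$ and $a+b=0$ then $a=b=0$. The product $a\cdot b$ in $P$ is written $ab$. **Multisign set.** Fix an integer $s\ge 1$ and let $D=\{0,1,\dots,s\}$. The set $\Sigma^{s}$ consists of formal pairs ${}^{d}p$ with sign $d\in D$ and magnitude $p\in P$, where the sign $0$ is reserved for the element ${}^{0}0$, and ${}^{0}0$ is the only element with magnitude $0$. Thus $\Sigma^{s}=\{{}^{0}0\}\cup\{{}^{d}p: d\in\{1,\dots,s\},\ p\in P\setminus\{0\}\}$. **Addition.** For ${}^{i}a,{}^{j}b\in\Sigma^{s}$: $${}^{i}a\oplus{}^{j}b=\begin{cases}{}^{i}(a+b)&\text{if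 } i=j,\\ {}^{i}(a-b)&\text{if } i\ne j,\ a>b,\\ {}^{j}(b-a)&\text{if } i\neq j,\ a<b,\\ {}^{0}0&\text{if } i\ne j,\ a=b.\end{cases}$$ **Multiplication.** For ${}^{i}a,{}^{j}b\in\Sigma^{s}$: $${}^{i}a\otimes{}^{j}b=\begin{cases}{}^{0}0&\text{if } {}^{i}a={}^{0}0\text{ or }{}^{j}b={}^{0}0,\\ {}^{\,i+j-1-s}(ab)&\text{if both are}\neq{}^{0}0\text{ and } i+j-1>s,\\ {}^{\,i+j-1}(ab)&\text{if both are}\neq{}^{0}0\text{ and } i+j-1\le s.\end{cases}$$ **Structures.** Below, all underlying sets are $\Sigma^s$, and $n\ge0$ is an integer. - *Signed-associativity* of an operation $\circledast$: ${}^{i}a\circledast({}^{j}b\circledast{}^{k}c)=({}^{i}a\circledast{}^{j}b)\circledast{}^{k}c$ whenever $|\{i,j,k\}|\le 2$. - *Signed-monoid*: closed under the operation, signed-associative, with two-sided identity. - *Abelian $n$i-signed-group*: closed under the operation, with an identity $e$, every $x\neq e$ having exactly $n$ distinct two-sided inverses (and $e$ being its own unique inverse), signed-associative, commutative. - *Commutative $n$i-signed-ring*: abelian $n$i-signed-group under addition, signed-monoid under multiplication, multiplication commutative and distributive over addition. - *$n$i-signed-field*: a commutative $n$i-signed-ring whose additive and multiplicative identities are distinct and in which every element other than the additive identity is invertible under multiplication. - *$n$i-signed-vector space* over an $n$i-signed-field $F$: a set $V$ with an addition making it an abelian $n$i-signed-group and a scalar multiplication $F\times V\to V$ whose signed-associativity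 ($\lambda(\mu v)=(\lambda\mu)v$ when the three signs take at most two values) and distributivity ($\lambda(v+w)=\lambda v+\lambda w$, $(\lambda+\mu)v=\lambda v+\mu v$) are consistent with the operations of $F$, and with $1\cdot v=v$ for all $v\in V$. Here $1={}^{1}1$. - *$n$i-signed-algebra* over $F$: an $n$i-signed-vector space $A$ over $F$ with a multiplication $A\times A\to A$ such that, for all $a,b,c\in A$, $\lambda\in F$: $\lambda\cdot(a\cdot b)=(\lambda\cdot a)\cdot b=a\cdot(\lambda\cdot b)$; $a\cdot(b+c)=(a\cdot b)+(a\cdot c)$; $(a+b)\cdot c=(a\cdot c)+(b\cdot c)$. *)

theory Defs
  imports "HOL-Algebra.Module"
begin

text \<open>Magnitudes. Multiplication is a total operation on the carrier, but only the nonzero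
  elements are required to form a group under it; in particular associativity and commutativity
  are not assumed for products involving \<open>\<zero>\<close>.\<close>

record 'a magnitudes = "'a ring" +
  leq :: "'a \<Rightarrow> 'a \<Rightarrow> bool" (infix \<open>\<preceq>\<index>\<close> 50)

locale magnitudes = abelian_monoid P for P (structure) +
  assumes mult_closed: "\<lbrakk>a \<in> carrier P; b \<in> carrier P\<rbrakk> \<Longrightarrow> a \<otimes> b \<in> carrier P"
    and nonzero_comm_group:
      "comm_group \<lparr>carrier = carrier P - {\<zero>}, mult = mult P, one = \<one>\<rparr>"
    and l_distr:
      "\<lbrakk>a \<in> carrier P; b \<in> carrier P; c \<in> carrier P\<rbrakk> \<Longrightarrow> (a \<oplus> b) \<otimes> c = (a \<otimes> c) \<oplus> (b \<otimes> c)"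
    and r_distr:
      "\<lbrakk>a \<in> carrier P; b \<in> carrier P; c \<in> carrier P\<rbrakk> \<Longrightarrow> a \<otimes> (b \<oplus> c) = (a \<otimes> b) \<oplus> (a \<otimes> c)"
    and leq_linear_order:
      "linear_order_on (carrier P) {(a, b). a \<in> carrier P \<and> b \<in> carrier P \<and> a \<preceq> b}"
    and leq_translation:
      "\<lbrakk>a \<in> carrier P; b \<in> carrier P; c \<in> carrier P; a \<preceq> b\<rbrakk> \<Longrightarrow> a \<oplus> c \<preceq> b \<oplus> c"
    and add_cancel:
      "\<lbrakk>a \<in> carrier P; b \<in> carrier P; c \<in> carrier P; a \<oplus> c = b \<oplus> c\<rbrakk> \<Longrightarrow> a = b"
    and difference_ex1:
      "\<lbrakk>a \<in> carrier P; b \<in> carrier P; b \<preceq> a\<rbrakk> \<Longrightarrow> \<exists>!c. c \<in> carrier P \<and> b \<oplus> c = a"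
    and no_add_inverses:
      "\<lbrakk>a \<in> carrier P; b \<in> carrier P; a \<oplus> b = \<zero>\<rbrakk> \<Longrightarrow> a = \<zero> \<and> b = \<zero>"

definition magnitude_less :: "('a, 'm) magnitudes_scheme \<Rightarrow> 'a \<Rightarrow> 'a \<Rightarrow> bool" (infix \<open>\<prec>\<index>\<close> 50)
  where "a \<prec>\<^bsub>P\<^esub> b \<longleftrightarrow> a \<preceq>\<^bsub>P\<^esub> b \<and> a \<noteq> b"

text \<open>Only meaningful for \<open>b \<preceq> a\<close>.\<close>

definition magnitude_diff :: "('a, 'm) magnitudes_scheme \<Rightarrow> 'a \<Rightarrow> 'a \<Rightarrow> 'a"
  where "magnitude_diff P a b = (THE c. c \<in> carrier P \<and> b \<oplus>\<^bsub>P\<^esub> c = a)"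

text \<open>The element with sign \<open>d\<close> and magnitude \<open>p\<close> is the pair \<open>(d, p)\<close>.\<close>

abbreviation sign :: "nat \<times> 'a \<Rightarrow> nat"
  where "sign \<equiv> fst"

definition multisign_set :: "nat \<Rightarrow> ('a, 'm) magnitudes_scheme \<Rightarrow> (nat \<times> 'a) set"
  where "multisign_set s P =
    {(0, \<zero>\<^bsub>P\<^esub>)} \<union> {(d, p). d \<in> {1..s} \<and> p \<in> carrier P - {\<zero>\<^bsub>P\<^esub>}}"

fun multisign_add :: "('a, 'm) magnitudes_scheme \<Rightarrow> nat \<times> 'a \<Rightarrow> nat \<times> 'a \<Rightarrow> nat \<times> 'a"
  where "multisign_add P (i, a) (j, b) =
    (if i = j then (i, a \<oplus>\<^bsub>P\<^esub> b)
     else if b \<prec>\<^bsub>P\<^esub> a then (i, magnitude_diff P a b)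
     else if a \<prec>\<^bsub>P\<^esub> b then (j, magnitude_diff P b a)
     else (0, \<zero>\<^bsub>P\<^esub>))"

fun multisign_mult :: "nat \<Rightarrow> ('a, 'm) magnitudes_scheme \<Rightarrow> nat \<times> 'a \<Rightarrow> nat \<times> 'a \<Rightarrow> nat \<times> 'a"
  where "multisign_mult s P (i, a) (j, b) =
    (if (i, a) = (0, \<zero>\<^bsub>P\<^esub>) \<or> (j, b) = (0, \<zero>\<^bsub>P\<^esub>) then (0, \<zero>\<^bsub>P\<^esub>)
     else if i + j - 1 > s then (i + j - 1 - s, a \<otimes>\<^bsub>P\<^esub> b)
     else (i + j - 1, a \<otimes>\<^bsub>P\<^esub> b))"

text \<open>Signed structures, for arbitrary sets of pairs whose first component is the sign.\<close>

locale signed_assoc =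
  fixes G :: "(nat \<times> 'a, 'm) monoid_scheme" (structure)
  assumes signed_assoc:
    "\<lbrakk>x \<in> carrier G; y \<in> carrier G; z \<in> carrier G; card {sign x, sign y, sign z} \<le> 2\<rbrakk>
      \<Longrightarrow> x \<otimes> (y \<otimes> z) = (x \<otimes> y) \<otimes> z"

locale signed_monoid = signed_assoc +
  assumes m_closed: "\<lbrakk>x \<in> carrier G; y \<in> carrier G\<rbrakk> \<Longrightarrow> x \<otimes> y \<in> carrier G"
    and one_closed: "\<one> \<in> carrier G"
    and l_one: "x \<in> carrier G \<Longrightarrow> \<one> \<otimes> x = x"
    and r_one: "x \<in> carrier G \<Longrightarrow> x \<otimes> \<one> = x"

definition two_sided_inverses :: "('a, 'm) monoid_scheme \<Rightarrow> 'a \<Rightarrow> 'a set"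
  where "two_sided_inverses G x =
    {y \<in> carrier G. x \<otimes>\<^bsub>G\<^esub> y = \<one>\<^bsub>G\<^esub> \<and> y \<otimes>\<^bsub>G\<^esub> x = \<one>\<^bsub>G\<^esub>}"

text \<open>Finiteness is explicit since \<open>card\<close> of an infinite set is \<open>0\<close>.\<close>

locale comm_signed_group = signed_monoid G
  for n :: nat and G :: "(nat \<times> 'a, 'm) monoid_scheme" (structure) +
  assumes inverses:
      "\<lbrakk>x \<in> carrier G; x \<noteq> \<one>\<rbrakk>
        \<Longrightarrow> finite (two_sided_inverses G x) \<and> card (two_sided_inverses G x) = n"
    and inverses_one: "two_sided_inverses G \<one> = {\<one>}"
    and m_comm: "\<lbrakk>x \<in> carrier G; y \<in> carrier G\<rbrakk> \<Longrightarrow> x \<otimes> y = y \<otimes> x"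

locale comm_signed_ring = signed_monoid R
  for n :: nat and R :: "(nat \<times> 'a, 'm) ring_scheme" (structure) +
  assumes add_comm_signed_group: "comm_signed_group n (add_monoid R)"
    and m_comm: "\<lbrakk>x \<in> carrier R; y \<in> carrier R\<rbrakk> \<Longrightarrow> x \<otimes> y = y \<otimes> x"
    and l_distr:
      "\<lbrakk>x \<in> carrier R; y \<in> carrier R; z \<in> carrier R\<rbrakk> \<Longrightarrow> (x \<oplus> y) \<otimes> z = (x \<otimes> z) \<oplus> (y \<otimes> z)"
    and r_distr:
      "\<lbrakk>x \<in> carrier R; y \<in> carrier R; z \<in> carrier R\<rbrakk> \<Longrightarrow> x \<otimes> (y \<oplus> z) = (x \<otimes> y) \<oplus> (x \<otimes> z)"

locale signed_field = comm_signed_ring n F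
  for n :: nat and F :: "(nat \<times> 'a, 'm) ring_scheme" (structure) +
  assumes zero_not_one: "\<zero> \<noteq> \<one>"
    and nonzero_invertible: "\<lbrakk>x \<in> carrier F; x \<noteq> \<zero>\<rbrakk> \<Longrightarrow> x \<in> Units F"

text \<open>As with \<open>module\<close>, the record fields \<open>mult\<close> and \<open>one\<close> of \<open>V\<close> play no role here.\<close>

locale signed_vector_space = signed_field n F
  for n :: nat
    and F :: "(nat \<times> 'a, 'm) ring_scheme" (structure)
    and V :: "(nat \<times> 'a, nat \<times> 'b, 'k) module_scheme" +
  assumes vector_add_comm_signed_group: "comm_signed_group n (add_monoid V)"
    and smult_closed: "\<lbrakk>k \<in> carrier F; v \<in> carrier V\<rbrakk> \<Longrightarrow> k \<odot>\<^bsub>V\<^esub> v \<in> carrier V"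
    and smult_signed_assoc:
      "\<lbrakk>k \<in> carrier F; l \<in> carrier F; v \<in> carrier V; card {sign k, sign l, sign v} \<le> 2\<rbrakk>
        \<Longrightarrow> k \<odot>\<^bsub>V\<^esub> (l \<odot>\<^bsub>V\<^esub> v) = (k \<otimes> l) \<odot>\<^bsub>V\<^esub> v"
    and smult_r_distr:
      "\<lbrakk>k \<in> carrier F; v \<in> carrier V; w \<in> carrier V\<rbrakk>
        \<Longrightarrow> k \<odot>\<^bsub>V\<^esub> (v \<oplus>\<^bsub>V\<^esub> w) = (k \<odot>\<^bsub>V\<^esub> v) \<oplus>\<^bsub>V\<^esub> (k \<odot>\<^bsub>V\<^esub> w)"
    and smult_l_distr:
      "\<lbrakk>k \<in> carrier F; l \<in> carrier F; v \<in> carrier V\<rbrakk>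
        \<Longrightarrow> (k \<oplus> l) \<odot>\<^bsub>V\<^esub> v = (k \<odot>\<^bsub>V\<^esub> v) \<oplus>\<^bsub>V\<^esub> (l \<odot>\<^bsub>V\<^esub> v)"
    and smult_one: "v \<in> carrier V \<Longrightarrow> \<one> \<odot>\<^bsub>V\<^esub> v = v"

text \<open>No unit and no associativity of the product of \<open>A\<close> is required.\<close>

locale signed_algebra = signed_vector_space n F A
  for n :: nat
    and F :: "(nat \<times> 'a, 'm) ring_scheme" (structure)
    and A :: "(nat \<times> 'a, nat \<times> 'b, 'k) module_scheme" +
  assumes alg_mult_closed: "\<lbrakk>a \<in> carrier A; b \<in> carrier A\<rbrakk> \<Longrightarrow> a \<otimes>\<^bsub>A\<^esub> b \<in> carrier A"
    and smult_mult_left: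
      "\<lbrakk>k \<in> carrier F; a \<in> carrier A; b \<in> carrier A\<rbrakk>
        \<Longrightarrow> k \<odot>\<^bsub>A\<^esub> (a \<otimes>\<^bsub>A\<^esub> b) = (k \<odot>\<^bsub>A\<^esub> a) \<otimes>\<^bsub>A\<^esub> b"
    and smult_mult_right:
      "\<lbrakk>k \<in> carrier F; a \<in> carrier A; b \<in> carrier A\<rbrakk>
        \<Longrightarrow> k \<odot>\<^bsub>A\<^esub> (a \<otimes>\<^bsub>A\<^esub> b) = a \<otimes>\<^bsub>A\<^esub> (k \<odot>\<^bsub>A\<^esub> b)"
    and alg_r_distr:
      "\<lbrakk>a \<in> carrier A; b \<in> carrier A; c \<in> carrier A\<rbrakk>
        \<Longrightarrow> a \<otimes>\<^bsub>A\<^esub> (b \<oplus>\<^bsub>A\<^esub> c) = (a \<otimes>\<^bsub>A\<^esub> b) \<oplus>\<^bsub>A\<^esub> (a \<otimes>\<^bsub>A\<^esub> c)"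
    and alg_l_distr:
      "\<lbrakk>a \<in> carrier A; b \<in> carrier A; c \<in> carrier A\<rbrakk>
        \<Longrightarrow> (a \<oplus>\<^bsub>A\<^esub> b) \<otimes>\<^bsub>A\<^esub> c = (a \<otimes>\<^bsub>A\<^esub> c) \<oplus>\<^bsub>A\<^esub> (b \<otimes>\<^bsub>A\<^esub> c)"

definition multisign_field :: "nat \<Rightarrow> ('a, 'm) magnitudes_scheme \<Rightarrow> (nat \<times> 'a) ring"
  where "multisign_field s P =
    \<lparr>carrier = multisign_set s P, mult = multisign_mult s P, one = (1, \<one>\<^bsub>P\<^esub>),
     zero = (0, \<zero>\<^bsub>P\<^esub>), add = multisign_add P\<rparr>"

text \<open>The multisign product serves both as scalar multiplication and as the algebra product.\<close>

definition multisign_algebra ::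
    "nat \<Rightarrow> ('a, 'm) magnitudes_scheme \<Rightarrow> (nat \<times> 'a, nat \<times> 'a) module"
  where "multisign_algebra s P =
    \<lparr>carrier = multisign_set s P, mult = multisign_mult s P, one = (1, \<one>\<^bsub>P\<^esub>),
     zero = (0, \<zero>\<^bsub>P\<^esub>), add = multisign_add P, smult = multisign_mult s P\<rparr>"

end

(* If the signs of x, y, z all lie in {0, i, k}, the sums x + (y + z) and (x + y) + z have the same
   balance between sign i and the remaining sign, as in the Grothendieck group of P; since P has no
   nonzero additive inverses, the balance determines the element. Everything else
   reduces to the fact that b = a, b = a + d or a = b + d with d nonzero, so that all truncated
   differences become cancellations, and to the cyclic group structure of the nonzero signs. *)

theory Submission
  imports Defs
begin

declare multisign_add.simps [simp del] multisign_mult.simps [simp del]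

section \<open>The cyclic group of nonzero signs\<close>

text \<open>After shifting each sign down by 1 this is addition modulo \<open>s\<close>, so {1..s}
  becomes the cyclic group of order \<open>s\<close> with neutral element 1.\<close>

definition sign_mult :: "nat \<Rightarrow> nat \<Rightarrow> nat \<Rightarrow> nat"
  where "sign_mult s i j = (if i + j - 1 > s then i + j - 1 - s else i + j - 1)"

lemma sign_mult_closed: "\<lbrakk>i \<in> {1..s}; j \<in> {1..s}\<rbrakk> \<Longrightarrow> sign_mult s i j \<in> {1..s}"
  by (auto simp: sign_mult_def)

lemma sign_mult_comm: "sign_mult s i j = sign_mult s j i"
  by (simp add: sign_mult_def add.commute)

lemma sign_mult_assoc:
  "\<lbrakk>i \<in> {1..s}; j \<in> {1..s}; k \<in> {1..s}\<rbrakk>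
    \<Longrightarrow> sign_mult s i (sign_mult s j k) = sign_mult s (sign_mult s i j) k"
  by (auto simp: sign_mult_def)

lemma sign_mult_left_cancel:
  "\<lbrakk>i \<in> {1..s}; j \<in> {1..s}; k \<in> {1..s}\<rbrakk> \<Longrightarrow> sign_mult s i j = sign_mult s i k \<longleftrightarrow> j = k"
  by (auto simp: sign_mult_def split: if_splits)

lemma sign_mult_1: "i \<in> {1..s} \<Longrightarrow> sign_mult s 1 i = i"
  by (auto simp: sign_mult_def)

lemma sign_mult_inverse: "i \<in> {1..s} \<Longrightarrow> \<exists>j \<in> {1..s}. sign_mult s i j = 1"
  \<comment> \<open>The product is 1 when i + j is 2 or s + 2. The second choice gives s + 1 for i =
    1, which is no sign, hence the case split.\<close>
  by (rule bexI[of _ "if i = 1 then 1 else s + 2 - i"]) (auto simp: sign_mult_def)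

text \<open>Turns the cardinality bound in signed associativity into two named signs, which may
  coincide.\<close>

lemma card_le_2_subset_pair:
  assumes "finite A" "card A \<le> 2"
  obtains a b where "A \<subseteq> {a, b}"
proof -
  consider "card A = 0" | "card A = 1" | "card A = 2" using assms by linarith
  then show thesis
    by cases (use assms that in \<open>auto simp: card_1_singleton_iff card_2_iff\<close>)
qed

context magnitudes
begin

section \<open>Order, cancellation and differences of magnitudes\<close>

lemma leq_cases:
  assumes "a \<in> carrier P" "b \<in> carrier P"
  shows "a \<preceq> b \<or> b \<preceq> a"
  using leq_linear_order assms
  by (cases "a = b")
    (auto simp: linear_order_on_def partial_order_on_def preorder_on_def total_on_def refl_on_def)

lemma leq_antisym: "\<lbrakk>a \<in> carrier P; b \<in> carrier P; a \<preceq> b; b \<preceq> a\<rbrakk> \<Longrightarrow> a = b"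
  using leq_linear_order
  by (auto simp: linear_order_on_def partial_order_on_def antisym_def)

lemma add_cancel_left:
  "\<lbrakk>a \<in> carrier P; b \<in> carrier P; c \<in> carrier P\<rbrakk> \<Longrightarrow> c \<oplus> a = c \<oplus> b \<longleftrightarrow> a = b"
  by (metis a_comm add_cancel)

lemma add_eq_self: "\<lbrakk>a \<in> carrier P; d \<in> carrier P\<rbrakk> \<Longrightarrow> a \<oplus> d = a \<longleftrightarrow> d = \<zero>"
  by (metis add_cancel_left r_zero zero_closed)

text \<open>If a were below zero instead, the difference c with a + c = 0 would force a = 0, since
  there are no nonzero additive inverses.\<close>

lemma zero_leq: "a \<in> carrier P \<Longrightarrow> \<zero> \<preceq> a"
  by (metis difference_ex1 leq_cases no_add_inverses zero_closed)

lemma less_add: "\<lbrakk>a \<in> carrier P; d \<in> carrier P; d \<noteq> \<zero>\<rbrakk> \<Longrightarrow> a \<prec> a \<oplus> d"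
  unfolding magnitude_less_def
  by (metis a_comm add_eq_self l_zero leq_translation zero_closed zero_leq)

text \<open>Discards the first comparison in \<open>multisign_add\<close>, so that the second is
  reached when the second summand is the larger one.\<close>

lemma not_add_less: "\<lbrakk>a \<in> carrier P; d \<in> carrier P; d \<noteq> \<zero>\<rbrakk> \<Longrightarrow> \<not> a \<oplus> d \<prec> a"
  using less_add[of a d] leq_antisym[of a "a \<oplus> d"] by (auto simp: magnitude_less_def)

lemma magnitude_diff_add: "\<lbrakk>a \<in> carrier P; d \<in> carrier P\<rbrakk> \<Longrightarrow> magnitude_diff P (a \<oplus> d) a = d"
  unfolding magnitude_diff_def by (rule the_equality) (auto simp: add_cancel_left)

text \<open>By totality one magnitude is below the other and \<open>difference_ex1\<close> supplies
  d; a vanishing d falls under the case \<open>eq\<close>.\<close>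

lemma magnitude_cases:
  assumes "a \<in> carrier P" "b \<in> carrier P"
  obtains (eq) "b = a"
    | (greater) d where "d \<in> carrier P" "d \<noteq> \<zero>" "a = b \<oplus> d"
    | (less) d where "d \<in> carrier P" "d \<noteq> \<zero>" "b = a \<oplus> d"
  using leq_cases[OF assms] difference_ex1[of a b] difference_ex1[of b a] assms
  by (metis r_zero)

section \<open>The group of nonzero magnitudes\<close>

lemma nonzero_mult:
  assumes "a \<in> carrier P" "b \<in> carrier P" "a \<noteq> \<zero>" "b \<noteq> \<zero>"
  shows "a \<otimes> b \<noteq> \<zero>" and "a \<otimes> b = b \<otimes> a"
proof -
  interpret N: comm_group "\<lparr>carrier = carrier P - {\<zero>}, mult = mult P, one = \<one>\<rparr>"
    by (rule nonzero_comm_group)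
  show "a \<otimes> b \<noteq> \<zero>" using N.m_closed[of a b] assms by simp
  show "a \<otimes> b = b \<otimes> a" using N.m_comm[of a b] assms by simp
qed

lemma nonzero_mult_assoc:
  assumes "a \<in> carrier P" "b \<in> carrier P" "c \<in> carrier P" "a \<noteq> \<zero>" "b \<noteq> \<zero>" "c \<noteq> \<zero>"
  shows "a \<otimes> (b \<otimes> c) = a \<otimes> b \<otimes> c"
proof -
  interpret N: comm_group "\<lparr>carrier = carrier P - {\<zero>}, mult = mult P, one = \<one>\<rparr>"
    by (rule nonzero_comm_group)
  show ?thesis using N.m_assoc[of a b c] assms by simp
qed

lemma one_nonzero: "\<one> \<in> carrier P" "\<one> \<noteq> \<zero>"
proof -
  interpret N: comm_group "\<lparr>carrier = carrier P - {\<zero>}, mult = mult P, one = \<one>\<rparr>"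
    by (rule nonzero_comm_group)
  show "\<one> \<in> carrier P" "\<one> \<noteq> \<zero>" using N.one_closed by simp_all
qed

lemma nonzero_one_mult:
  assumes "a \<in> carrier P" "a \<noteq> \<zero>"
  shows "\<one> \<otimes> a = a"
proof -
  interpret N: comm_group "\<lparr>carrier = carrier P - {\<zero>}, mult = mult P, one = \<one>\<rparr>"
    by (rule nonzero_comm_group)
  show ?thesis using N.l_one[of a] assms by simp
qed

lemma nonzero_inverse:
  assumes "a \<in> carrier P" "a \<noteq> \<zero>"
  obtains b where "b \<in> carrier P" "b \<noteq> \<zero>" "a \<otimes> b = \<one>"
proof -
  interpret N: comm_group "\<lparr>carrier = carrier P - {\<zero>}, mult = mult P, one = \<one>\<rparr>"
    by (rule nonzero_comm_group)
  show thesis using N.r_inv_ex[of a] assms that by auto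
qed

section \<open>Membership and addition in the multisign set\<close>

lemma multisign_cases:
  assumes "x \<in> multisign_set s P"
  obtains (zero) "x = (0, \<zero>)"
    | (nonzero) i a where "x = (i, a)" "i \<in> {1..s}" "a \<in> carrier P" "a \<noteq> \<zero>"
  using assms by (auto simp: multisign_set_def)

lemma zero_in_multisign_set: "(0, \<zero>) \<in> multisign_set s P"
  by (simp add: multisign_set_def)

lemma multisign_setI:
  "\<lbrakk>i \<in> {1..s}; a \<in> carrier P; a \<noteq> \<zero>\<rbrakk> \<Longrightarrow> (i, a) \<in> multisign_set s P"
  by (simp add: multisign_set_def)

lemma magnitude_closed: "x \<in> multisign_set s P \<Longrightarrow> snd x \<in> carrier P"
  by (auto simp: multisign_set_def)

lemma multisign_add_same: "multisign_add P (i, a) (i, b) = (i, a \<oplus> b)"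
  by (simp add: multisign_add.simps)

lemma multisign_add_equal: "i \<noteq> j \<Longrightarrow> multisign_add P (i, a) (j, a) = (0, \<zero>)"
  by (simp add: multisign_add.simps magnitude_less_def)

lemma multisign_add_greater:
  "\<lbrakk>i \<noteq> j; a \<in> carrier P; d \<in> carrier P; d \<noteq> \<zero>\<rbrakk> \<Longrightarrow> multisign_add P (i, a \<oplus> d) (j, a) = (i, d)"
  by (simp add: multisign_add.simps less_add magnitude_diff_add)

lemma multisign_add_less:
  "\<lbrakk>i \<noteq> j; a \<in> carrier P; d \<in> carrier P; d \<noteq> \<zero>\<rbrakk> \<Longrightarrow> multisign_add P (i, a) (j, a \<oplus> d) = (j, d)"
  by (simp add: multisign_add.simps less_add not_add_less magnitude_diff_add)

lemmas multisign_add_simps =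
  multisign_add_same multisign_add_equal multisign_add_greater multisign_add_less

lemma multisign_add_zero:
  assumes "x \<in> multisign_set s P"
  shows "multisign_add P (0, \<zero>) x = x" and "multisign_add P x (0, \<zero>) = x"
proof -
  show "multisign_add P (0, \<zero>) x = x"
    using assms
  proof (cases rule: multisign_cases)
    case (nonzero i a)
    \<comment> \<open>The signs 0 and i differ, so this is the rule for unequal signs with smaller
      magnitude zero and difference a.\<close>
    then show ?thesis using multisign_add_less[of 0 i \<zero> a] by simp
  qed (simp add: multisign_add_same)
  show "multisign_add P x (0, \<zero>) = x"
    using assms
  proof (cases rule: multisign_cases)
    case (nonzero i a)
    then show ?thesis using multisign_add_greater[of i 0 \<zero> a] by simp
  qed (simp add: multisign_add_same)
qed

lemma multisign_add_comm:
  assumes "x \<in> multisign_set s P" "y \<in> multisign_set s P"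
  shows "multisign_add P x y = multisign_add P y x"
proof -
  obtain i a j b where xy: "x = (i, a)" "y = (j, b)" by fastforce
  have ab: "a \<in> carrier P" "b \<in> carrier P" using assms magnitude_closed xy by force+
  show ?thesis
  proof (cases "i = j")
    case True
    then show ?thesis using ab by (simp add: xy multisign_add_same a_comm)
  next
    case False
    from ab show ?thesis unfolding xy
      by (cases rule: magnitude_cases)
        (use False ab in \<open>simp_all add: multisign_add_simps\<close>)
  qed
qed

text \<open>For equal signs the sum keeps its nonzero sign, so its magnitude must not vanish; the
  absence of additive inverses in P ensures this.\<close>

lemma multisign_add_nonzero_closed:
  assumes "i \<in> {1..s}" "a \<in> carrier P" "a \<noteq> \<zero>" "j \<in> {1..s}" "b \<in> carrier P" "b \<noteq> \<zero>"
  shows "multisign_add P (i, a) (j, b) \<in> multisign_set s P"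
proof (cases "i = j")
  case True
  then show ?thesis using assms no_add_inverses[of a b]
    by (auto simp: multisign_add_same intro: multisign_setI)
next
  case False
  from assms(2,5) show ?thesis
    by (cases rule: magnitude_cases)
      (use False assms in \<open>simp_all add: multisign_add_simps zero_in_multisign_set multisign_setI\<close>)
qed

lemma multisign_add_closed:
  assumes "x \<in> multisign_set s P" "y \<in> multisign_set s P"
  shows "multisign_add P x y \<in> multisign_set s P"
  using assms(1)
proof (cases rule: multisign_cases)
  case zero
  then show ?thesis using assms multisign_add_zero by simp
next
  case x: (nonzero i a)
  from assms(2) show ?thesis
    by (cases rule: multisign_cases)
      (use x assms multisign_add_zero multisign_add_nonzero_closed in simp_all)
qed

section \<open>Balance and signed associativity of addition\<close>

text \<open>Together with \<open>magnitude_off\<close> this encodes the formal difference on - off: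
  sign i counts positively, every other sign negatively, and the zero element contributes
  nothing.\<close>

definition magnitude_on :: "nat \<Rightarrow> nat \<times> 'a \<Rightarrow> 'a"
  where "magnitude_on i x = (if sign x = i then snd x else \<zero>)"

definition magnitude_off :: "nat \<Rightarrow> nat \<times> 'a \<Rightarrow> 'a"
  where "magnitude_off i x = (if sign x = i then \<zero> else snd x)"

lemma magnitude_on_off_closed:
  "x \<in> multisign_set s P \<Longrightarrow> magnitude_on i x \<in> carrier P"
  "x \<in> multisign_set s P \<Longrightarrow> magnitude_off i x \<in> carrier P"
  by (simp_all add: magnitude_on_def magnitude_off_def magnitude_closed)

text \<open>A sum takes its sign from a summand or, after complete cancellation, has sign 0.
  Including 0 therefore makes the set of signs stable under addition.\<close>

lemma sign_multisign_add:
  "\<lbrakk>sign x \<in> {0, i, k}; sign y \<in> {0, i, k}\<rbrakk> \<Longrightarrow> sign (multisign_add P x y) \<in> {0, i, k}"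
  by (cases x; cases y) (simp add: multisign_add.simps)

text \<open>Additivity of on - off, written without subtraction. Two distinct nonzero signs both
  different from i would cancel in \<open>multisign_add\<close> but accumulate in the balance; the
  restriction to {0, i, k} excludes them.\<close>

lemma multisign_add_balance:
  assumes "x \<in> multisign_set s P" "y \<in> multisign_set s P"
    and "sign x \<in> {0, i, k}" "sign y \<in> {0, i, k}"
  shows "magnitude_on i (multisign_add P x y) \<oplus> (magnitude_off i x \<oplus> magnitude_off i y) =
    magnitude_off i (multisign_add P x y) \<oplus> (magnitude_on i x \<oplus> magnitude_on i y)"
proof -
  consider "x = (0, \<zero>)" | "y = (0, \<zero>)"
    | j a l b where "x = (j, a)" "j \<noteq> 0" "a \<in> carrier P" "y = (l, b)" "l \<noteq> 0" "b \<in> carrier P"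
    using assms(1,2) by (auto simp: multisign_set_def)
  then show ?thesis
  proof cases
    case 1
    then show ?thesis
      using assms magnitude_closed multisign_add_zero
      by (simp add: magnitude_on_def magnitude_off_def)
  next
    case 2
    then show ?thesis
      using assms magnitude_closed multisign_add_zero
      by (simp add: magnitude_on_def magnitude_off_def)
  next
    case 3
    show ?thesis
    proof (cases "j = l")
      case True
      then show ?thesis using 3 by (simp add: multisign_add_same magnitude_on_def magnitude_off_def)
    next
      case False
      \<comment> \<open>Here j and l are i and k in some order, and the truncated difference removes
        the same magnitude from both sides of the balance.\<close>
      from 3(3,6) show ?thesis
      proof (cases rule: magnitude_cases)
        case eq
        then show ?thesis
          using False 3 assms(3,4)
          by (auto simp: multisign_add_equal magnitude_on_def magnitude_off_def)
      next
        case (greater d)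
        then have "multisign_add P x y = (j, d)" using False 3 by (simp add: multisign_add_greater)
        then show ?thesis
          using False 3 assms(3,4) greater by (auto simp: magnitude_on_def magnitude_off_def a_comm)
      next
        case (less d)
        then have "multisign_add P x y = (l, d)" using False 3 by (simp add: multisign_add_less)
        then show ?thesis
          using False 3 assms(3,4) less by (auto simp: magnitude_on_def magnitude_off_def a_comm)
      qed
    qed
  qed
qed

text \<open>If exactly one element has sign i, equal balances make the sum of the two magnitudes
  zero, so both elements are zero. Otherwise the magnitudes agree.\<close>

lemma multisign_eqI_balance:
  assumes "x \<in> multisign_set s P" "y \<in> multisign_set s P"
    and "sign x \<in> {0, i, k}" "sign y \<in> {0, i, k}"
    and "magnitude_on i x \<oplus> magnitude_off i y = magnitude_off i x \<oplus> magnitude_on i y"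
  shows "x = y"
proof -
  have xy: "snd x \<in> carrier P" "snd y \<in> carrier P" using assms magnitude_closed by blast+
  consider "sign x = i" "sign y \<noteq> i" | "sign x \<noteq> i" "sign y = i" | "sign x = i \<longleftrightarrow> sign y = i"
    by blast
  then show ?thesis
  proof cases
    case 1
    then have "snd x \<oplus> snd y = \<zero>" using assms(5) by (simp add: magnitude_on_def magnitude_off_def)
    then have "snd x = \<zero>" "snd y = \<zero>" using xy no_add_inverses by blast+
    then show ?thesis using assms(1,2) by (auto simp: multisign_set_def)
  next
    case 2
    then have "snd x \<oplus> snd y = \<zero>" using assms(5) by (simp add: magnitude_on_def magnitude_off_def)
    then have "snd x = \<zero>" "snd y = \<zero>" using xy no_add_inverses by blast+
    then show ?thesis using assms(1,2) by (auto simp: multisign_set_def)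
  next
    case 3
    then have "snd x = snd y"
      using assms(5) xy by (auto simp: magnitude_on_def magnitude_off_def split: if_splits)
    \<comment> \<open>Away from i the only signs are 0 and k, and whether the magnitude vanishes
      decides between them.\<close>
    then show ?thesis using 3 assms(1-4) by (auto simp: multisign_set_def)
  qed
qed

text \<open>In terms of differences: p - q = (a - b) + (p' - q') and p' - q' = c - d. It composes
  the balance of an outer sum with that of an inner one.\<close>

lemma balance_add:
  assumes "p \<in> carrier P" "q \<in> carrier P" "a \<in> carrier P" "b \<in> carrier P"
    and "p' \<in> carrier P" "q' \<in> carrier P" "c \<in> carrier P" "d \<in> carrier P"
    and "p \<oplus> (b \<oplus> q') = q \<oplus> (a \<oplus> p')" "p' \<oplus> d = q' \<oplus> c"
  shows "p \<oplus> (b \<oplus> d) = q \<oplus> (a \<oplus> c)"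
proof -
  \<comment> \<open>Padding with q' + p' makes both hypotheses applicable by regrouping; the padding
    is cancelled at the end.\<close>
  have "(p \<oplus> (b \<oplus> d)) \<oplus> (q' \<oplus> p') = (p \<oplus> (b \<oplus> q')) \<oplus> (p' \<oplus> d)"
    using assms(1-8) by (simp add: a_ac)
  also have "\<dots> = (q \<oplus> (a \<oplus> p')) \<oplus> (q' \<oplus> c)" by (simp only: assms(9,10))
  also have "\<dots> = (q \<oplus> (a \<oplus> c)) \<oplus> (q' \<oplus> p')" using assms(1-8) by (simp add: a_ac)
  finally show ?thesis using assms by (meson a_closed add_cancel)
qed

lemma multisign_add_signed_assoc:
  assumes "x \<in> multisign_set s P" "y \<in> multisign_set s P" "z \<in> multisign_set s P"
    and "card {sign x, sign y, sign z} \<le> 2"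
  shows "multisign_add P x (multisign_add P y z) = multisign_add P (multisign_add P x y) z"
proof -
  obtain i k where "{sign x, sign y, sign z} \<subseteq> {i, k}"
    using card_le_2_subset_pair[OF _ assms(4)] by blast
  then have sg: "sign x \<in> {0, i, k}" "sign y \<in> {0, i, k}" "sign z \<in> {0, i, k}" by auto
  let ?p = "magnitude_on i" and ?q = "magnitude_off i"
  let ?yz = "multisign_add P y z" and ?xy = "multisign_add P x y"
  let ?u = "multisign_add P x ?yz" and ?v = "multisign_add P ?xy z"
  have sg2: "sign ?yz \<in> {0, i, k}" "sign ?xy \<in> {0, i, k}" "sign ?u \<in> {0, i, k}" "sign ?v \<in> {0, i, k}"
    by (intro sign_multisign_add sg)+
  have mem: "?yz \<in> multisign_set s P" "?xy \<in> multisign_set s P" "?u \<in> multisign_set s P"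
    "?v \<in> multisign_set s P"
    by (intro multisign_add_closed assms(1-3))+
  note c = assms(1-3)[THEN magnitude_on_off_closed(1)] assms(1-3)[THEN magnitude_on_off_closed(2)]
    mem[THEN magnitude_on_off_closed(1)] mem[THEN magnitude_on_off_closed(2)]
  have "?p ?u \<oplus> (?q x \<oplus> (?q y \<oplus> ?q z)) = ?q ?u \<oplus> (?p x \<oplus> (?p y \<oplus> ?p z))"
    by (rule balance_add[where p' = "?p ?yz" and q' = "?q ?yz"])
      (rule a_closed c multisign_add_balance[OF assms(1) mem(1) sg(1) sg2(1)]
        multisign_add_balance[OF assms(2,3) sg(2,3)])+
  then have u: "?p ?u \<oplus> (?q x \<oplus> ?q y \<oplus> ?q z) = ?q ?u \<oplus> (?p x \<oplus> ?p y \<oplus> ?p z)"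
    using c by (simp add: a_assoc)
  \<comment> \<open>The outer summand z is put first, so that the inner sum x + y occupies the place
    \<open>balance_add\<close> expects.\<close>
  have v0: "?p ?v \<oplus> (?q z \<oplus> ?q ?xy) = ?q ?v \<oplus> (?p z \<oplus> ?p ?xy)"
    using multisign_add_balance[OF mem(2) assms(3) sg2(2) sg(3)] c
    by (simp add: a_comm)
  have "?p ?v \<oplus> (?q z \<oplus> (?q x \<oplus> ?q y)) = ?q ?v \<oplus> (?p z \<oplus> (?p x \<oplus> ?p y))"
    by (rule balance_add[where p' = "?p ?xy" and q' = "?q ?xy"])
      (rule a_closed c v0 multisign_add_balance[OF assms(1,2) sg(1,2)])+
  then have v: "?p ?v \<oplus> (?q x \<oplus> ?q y \<oplus> ?q z) = ?q ?v \<oplus> (?p x \<oplus> ?p y \<oplus> ?p z)"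
    using c by (simp add: a_comm)
  \<comment> \<open>Both bracketings have the total balance of x, y and z. Crossing \<open>u\<close>
    with \<open>v\<close> and cancelling the common off-total gives the premise of
    \<open>multisign_eqI_balance\<close>.\<close>
  have "(?p ?u \<oplus> ?q ?v) \<oplus> (?q x \<oplus> ?q y \<oplus> ?q z) = (?p ?u \<oplus> (?q x \<oplus> ?q y \<oplus> ?q z)) \<oplus> ?q ?v"
    using c by (simp add: a_ac)
  also have "\<dots> = ?q ?u \<oplus> (?q ?v \<oplus> (?p x \<oplus> ?p y \<oplus> ?p z))"
    unfolding u using c by (simp add: a_ac)
  also have "\<dots> = (?q ?u \<oplus> ?p ?v) \<oplus> (?q x \<oplus> ?q y \<oplus> ?q z)"
    unfolding v[symmetric] using c by (simp add: a_ac)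
  finally have "?p ?u \<oplus> ?q ?v = ?q ?u \<oplus> ?p ?v"
    using c by (meson a_closed add_cancel)
  then show ?thesis
    using multisign_eqI_balance mem sg2 by metis
qed

section \<open>Additive inverses\<close>

text \<open>Equal signs never cancel, and unequal ones cancel only at equal magnitude. This is the
  source of the count n = s - 1.\<close>

lemma multisign_additive_inverses:
  assumes "i \<in> {1..s}" "a \<in> carrier P" "a \<noteq> \<zero>"
  shows "{y \<in> multisign_set s P. multisign_add P (i, a) y = (0, \<zero>)} = ({1..s} - {i}) \<times> {a}"
    (is "?L = ?R")
proof
  show "?L \<subseteq> ?R"
  proof
    fix y assume "y \<in> ?L"
    then have y: "y \<in> multisign_set s P" and sum: "multisign_add P (i, a) y = (0, \<zero>)" by auto
    from y show "y \<in> ?R"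
    proof (cases rule: multisign_cases)
      case zero
      then show ?thesis using sum assms multisign_add_zero(2)[OF multisign_setI[OF assms]] by simp
    next
      case (nonzero j b)
      have "i \<noteq> j" using sum assms nonzero by (auto simp: multisign_add_same)
      moreover have "b = a"
        using assms(2) nonzero(3)
        by (cases rule: magnitude_cases)
          (use \<open>i \<noteq> j\<close> sum nonzero assms in
            \<open>simp_all add: multisign_add_simps\<close>)
      ultimately show ?thesis using nonzero by auto
    qed
  qed
  show "?R \<subseteq> ?L"
    using assms multisign_add_equal by (auto intro: multisign_setI)
qed

section \<open>Multiplication\<close>

lemma multisign_mult_zero:
  "multisign_mult s P (0, \<zero>) x = (0, \<zero>)" "multisign_mult s P x (0, \<zero>) = (0, \<zero>)"
  by (cases x; simp add: multisign_mult.simps)+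

lemma multisign_mult_nonzero:
  "\<lbrakk>a \<noteq> \<zero>; b \<noteq> \<zero>\<rbrakk> \<Longrightarrow> multisign_mult s P (i, a) (j, b) = (sign_mult s i j, a \<otimes> b)"
  by (simp add: multisign_mult.simps sign_mult_def)

lemmas multisign_mult_simps =
  multisign_mult_zero multisign_mult_nonzero mult_closed nonzero_mult(1)

lemma multisign_mult_closed:
  assumes "x \<in> multisign_set s P" "y \<in> multisign_set s P"
  shows "multisign_mult s P x y \<in> multisign_set s P"
  using assms
  by (elim multisign_cases)
    (simp_all add: multisign_mult_simps zero_in_multisign_set multisign_setI sign_mult_closed
      del: One_nat_def atLeastAtMost_iff)

lemma multisign_mult_comm:
  assumes "x \<in> multisign_set s P" "y \<in> multisign_set s P"
  shows "multisign_mult s P x y = multisign_mult s P y x"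
  using assms
  by (elim multisign_cases)
    (simp_all add: multisign_mult_simps sign_mult_comm nonzero_mult(2))

text \<open>Zero absorbs, and the nonzero elements form the product of the cyclic group of signs
  with the group of nonzero magnitudes. Compatibility of scalar and algebra products requires
  associativity for arbitrary signs.\<close>

lemma multisign_mult_assoc:
  assumes "x \<in> multisign_set s P" "y \<in> multisign_set s P" "z \<in> multisign_set s P"
  shows "multisign_mult s P x (multisign_mult s P y z) =
    multisign_mult s P (multisign_mult s P x y) z"
  using assms
  by (elim multisign_cases)
    (simp_all add: multisign_mult_simps sign_mult_assoc nonzero_mult_assoc
      del: One_nat_def atLeastAtMost_iff)

lemma multisign_one_mult:
  assumes "x \<in> multisign_set s P"
  shows "multisign_mult s P (1, \<one>) x = x"
  using assms
  by (elim multisign_cases)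
    (simp_all only: multisign_mult_simps sign_mult_1 nonzero_one_mult one_nonzero not_False_eq_True)

section \<open>Distributivity and multiplicative inverses\<close>

text \<open>Multiplication by sign k is injective on signs and multiplication by c scales a
  difference d to the nonzero c d. Hence both sides fall under the same case of addition.\<close>

lemma multisign_mult_add_distrib_nonzero:
  assumes "i \<in> {1..s}" "a \<in> carrier P" "a \<noteq> \<zero>" "j \<in> {1..s}" "b \<in> carrier P" "b \<noteq> \<zero>"
    and "k \<in> {1..s}" "c \<in> carrier P" "c \<noteq> \<zero>"
  shows "multisign_mult s P (k, c) (multisign_add P (i, a) (j, b)) =
    multisign_add P (multisign_mult s P (k, c) (i, a)) (multisign_mult s P (k, c) (j, b))"
proof (cases "i = j")
  case True
  have "a \<oplus> b \<noteq> \<zero>" using assms no_add_inverses by blast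
  then show ?thesis
    using True assms r_distr[of c a b]
    by (simp add: multisign_mult_simps multisign_add_same)
next
  case False
  then have ne: "sign_mult s k i \<noteq> sign_mult s k j" using assms sign_mult_left_cancel by blast
  from assms(2,5) show ?thesis
  proof (cases rule: magnitude_cases)
    case eq
    then show ?thesis
      using False ne assms(3,9)
      by (simp add: multisign_add_equal multisign_mult_zero multisign_mult_nonzero)
  next
    case (greater d)
    then have "c \<otimes> a = c \<otimes> b \<oplus> c \<otimes> d" using assms r_distr by simp
    moreover have "multisign_add P (i, a) (j, b) = (i, d)"
      unfolding greater(3) using False assms(5) greater(1,2) by (rule multisign_add_greater)
    ultimately show ?thesis
      using multisign_add_greater[OF ne, of "c \<otimes> b" "c \<otimes> d"] greater(1,2) assms
      by (simp add: multisign_mult_nonzero mult_closed nonzero_mult(1))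
  next
    case (less d)
    then have "c \<otimes> b = c \<otimes> a \<oplus> c \<otimes> d" using assms r_distr by simp
    moreover have "multisign_add P (i, a) (j, b) = (j, d)"
      unfolding less(3) using False assms(2) less(1,2) by (rule multisign_add_less)
    ultimately show ?thesis
      using multisign_add_less[OF ne, of "c \<otimes> a" "c \<otimes> d"] less(1,2) assms
      by (simp add: multisign_mult_nonzero mult_closed nonzero_mult(1))
  qed
qed

lemma multisign_mult_add_distrib:
  assumes "x \<in> multisign_set s P" "y \<in> multisign_set s P" "z \<in> multisign_set s P"
  shows "multisign_mult s P z (multisign_add P x y) =
    multisign_add P (multisign_mult s P z x) (multisign_mult s P z y)"
  using assms(1)
proof (cases rule: multisign_cases)
  case zero
  then show ?thesis
    using assms(2) multisign_add_zero(1)[OF multisign_mult_closed[OF assms(3,2)]]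
    by (simp add: multisign_mult_zero multisign_add_zero)
next
  case x: (nonzero i a)
  from assms(2) show ?thesis
  proof (cases rule: multisign_cases)
    case zero
    then show ?thesis
      using assms(1) multisign_add_zero(2)[OF multisign_mult_closed[OF assms(3,1)]]
      by (simp add: multisign_mult_zero multisign_add_zero)
  next
    case y: (nonzero j b)
    from assms(3) show ?thesis
    proof (cases rule: multisign_cases)
      case zero
      then show ?thesis
        using multisign_add_zero(1)[OF zero_in_multisign_set[of s]] by (simp add: multisign_mult_zero)
    next
      case (nonzero k c)
      then show ?thesis
        using multisign_mult_add_distrib_nonzero[OF x(2-4) y(2-4) nonzero(2-4)] x(1) y(1) by simp
    qed
  qed
qed

lemma multisign_add_mult_distrib:
  assumes "x \<in> multisign_set s P" "y \<in> multisign_set s P" "z \<in> multisign_set s P"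
  shows "multisign_mult s P (multisign_add P x y) z =
    multisign_add P (multisign_mult s P x z) (multisign_mult s P y z)"
  using multisign_mult_add_distrib[OF assms]
  unfolding multisign_mult_comm[OF assms(1,3)] multisign_mult_comm[OF assms(2,3)]
    multisign_mult_comm[OF multisign_add_closed[OF assms(1,2)] assms(3)] .

lemma multisign_mult_inverse:
  assumes "x \<in> multisign_set s P" "x \<noteq> (0, \<zero>)"
  shows "\<exists>y \<in> multisign_set s P. multisign_mult s P x y = (1, \<one>)"
  using assms(1)
proof (cases rule: multisign_cases)
  case (nonzero i a)
  obtain j where j: "j \<in> {1..s}" "sign_mult s i j = 1"
    using sign_mult_inverse[OF nonzero(2)] by blast
  obtain b where b: "b \<in> carrier P" "b \<noteq> \<zero>" "a \<otimes> b = \<one>"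
    using nonzero_inverse[OF nonzero(3,4)] by blast
  show ?thesis
    using multisign_mult_nonzero[OF nonzero(4) b(2)] j(2) b(3) nonzero(1)
    by (intro bexI[OF _ multisign_setI[OF j(1) b(1,2)]]) simp
qed (use assms in simp)

section \<open>The signed group, field and algebra\<close>

text \<open>Stated for an arbitrary record because the additive monoids of the field and of the
  algebra have different types.\<close>

lemma comm_signed_group_multisign:
  fixes G :: "(nat \<times> 'a, 'c) monoid_scheme"
  assumes "carrier G = multisign_set s P" "mult G = multisign_add P" "one G = (0, \<zero>)"
  shows "comm_signed_group (s - 1) G"
proof
  fix x assume x: "x \<in> carrier G" "x \<noteq> \<one>\<^bsub>G\<^esub>"
  then obtain i a where ia: "x = (i, a)" "i \<in> {1..s}" "a \<in> carrier P" "a \<noteq> \<zero>"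
    using assms by (auto elim: multisign_cases)
  have "two_sided_inverses G x = {y \<in> multisign_set s P. multisign_add P x y = (0, \<zero>)}"
    using x multisign_add_comm unfolding two_sided_inverses_def assms by metis
  also have "\<dots> = ({1..s} - {i}) \<times> {a}" using multisign_additive_inverses ia by simp
  finally show "finite (two_sided_inverses G x) \<and> card (two_sided_inverses G x) = s - 1"
    using ia by (simp add: card_cartesian_product)
next
  show "two_sided_inverses G \<one>\<^bsub>G\<^esub> = {\<one>\<^bsub>G\<^esub>}"
    using multisign_add_zero zero_in_multisign_set
    unfolding two_sided_inverses_def assms by auto
qed (unfold assms, (rule multisign_add_signed_assoc multisign_add_closed multisign_add_zero
    zero_in_multisign_set multisign_add_comm; assumption)+)

lemma multisign_field_simps:
  "carrier (multisign_field s P) = multisign_set s P"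
  "mult (multisign_field s P) = multisign_mult s P"
  "one (multisign_field s P) = (1, \<one>)"
  "zero (multisign_field s P) = (0, \<zero>)"
  "add (multisign_field s P) = multisign_add P"
  by (simp_all add: multisign_field_def)

lemma signed_field_multisign:
  assumes "s \<ge> 1"
  shows "signed_field (s - 1) (multisign_field s P)"
proof -
  let ?F = "multisign_field s P"
  \<comment> \<open>Here s \<ge> 1 enters: otherwise there is no sign 1.\<close>
  have one: "(1, \<one>) \<in> multisign_set s P"
    using assms one_nonzero by (simp add: multisign_set_def)
  interpret add: comm_signed_group "s - 1" "add_monoid ?F"
    by (rule comm_signed_group_multisign) (simp_all add: multisign_field_simps)
  show ?thesis
  proof
    show "x \<in> Units ?F" if "x \<in> carrier ?F" "x \<noteq> \<zero>\<^bsub>?F\<^esub>" for x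
    proof -
      have x: "x \<in> multisign_set s P" "x \<noteq> (0, \<zero>)" using that by (simp_all add: multisign_field_simps)
      then obtain y where "y \<in> multisign_set s P" "multisign_mult s P x y = (1, \<one>)"
        using multisign_mult_inverse by blast
      then show ?thesis
        using x(1) multisign_mult_comm[of x s y] by (auto simp: multisign_field_simps Units_def)
    qed
    show "x \<otimes>\<^bsub>?F\<^esub> \<one>\<^bsub>?F\<^esub> = x" if "x \<in> carrier ?F" for x
      using that multisign_one_mult multisign_mult_comm[OF _ one] unfolding multisign_field_simps
      by simp
    show "\<zero>\<^bsub>?F\<^esub> \<noteq> \<one>\<^bsub>?F\<^esub>" by (simp add: multisign_field_simps)
  qed (unfold multisign_field_simps, (rule multisign_mult_assoc multisign_mult_closed one
      multisign_one_mult multisign_mult_comm multisign_add_mult_distrib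
      multisign_mult_add_distrib; assumption)+)
qed

lemma signed_algebra_multisign:
  assumes "s \<ge> 1"
  shows "signed_algebra (s - 1) (multisign_field s P) (multisign_algebra s P)"
proof -
  interpret F: signed_field "s - 1" "multisign_field s P"
    using assms by (rule signed_field_multisign)
  let ?F = "multisign_field s P" and ?A = "multisign_algebra s P"
  \<comment> \<open>Scalar and algebra product are both the product of F, so every remaining axiom
    becomes a law of F.\<close>
  have eq: "carrier ?A = carrier ?F" "add ?A = add ?F" "mult ?A = mult ?F" "smult ?A = mult ?F"
    by (simp_all add: multisign_field_def multisign_algebra_def)
  have assoc: "x \<otimes>\<^bsub>?F\<^esub> (y \<otimes>\<^bsub>?F\<^esub> z) = (x \<otimes>\<^bsub>?F\<^esub> y) \<otimes>\<^bsub>?F\<^esub> z"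
    if "x \<in> carrier ?F" "y \<in> carrier ?F" "z \<in> carrier ?F" for x y z
    using that multisign_mult_assoc unfolding multisign_field_simps by blast
  \<comment> \<open>Needed for \<open>smult_mult_right\<close>, where the scalar has to pass the
    first factor.\<close>
  have left_comm: "x \<otimes>\<^bsub>?F\<^esub> (y \<otimes>\<^bsub>?F\<^esub> z) = y \<otimes>\<^bsub>?F\<^esub> (x \<otimes>\<^bsub>?F\<^esub> z)"
    if "x \<in> carrier ?F" "y \<in> carrier ?F" "z \<in> carrier ?F" for x y z
    using that assoc F.m_comm by metis
  interpret add: comm_signed_group "s - 1" "add_monoid ?A"
    by (rule comm_signed_group_multisign) (simp_all add: multisign_algebra_def)
  show ?thesis
    by unfold_locales
      (unfold eq, (rule F.m_closed F.l_one F.l_distr F.r_distr assoc left_comm; assumption)+)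
qed

end

theorem theorem3p39:
  fixes P :: "('a, 'm) magnitudes_scheme" and s n :: nat
  assumes "magnitudes P" and "s \<ge> 1" and "n = s - 1"
  shows "signed_algebra n (multisign_field s P) (multisign_algebra s P)"
  using magnitudes.signed_algebra_multisign assms by blast

end
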